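(* Let $(M_{n,2}(x))_{n\ge0}$ and $(\widetilde M_{n,2}(x))_{n\ge0}$ be defined by $M_{0,2}(x)=1$, $\widetilde M_{0,2}(x)=1$ and, for $n\ge1$, $$M_{n,2}(x)=\bigl[(2n-2)x+1\bigr]M_{n-1,2}(x)+2x(1-x)\frac{d}{dx}M_{n-1,2}(x),$$ $$\widetilde M_{n,2}(x)=(2n-1)x\,\widetilde M_{n-1,2}(x)+2x(1-x)\frac{d}{dx}\widetilde M_{n-1,2}(x)$$ (so $M_{1,2}=1$, $M_{2,2}=1+2x$, $\widetilde M_{1,2}=x$), and let $T_{n,2}(x)$ be the polynomial defined by $(1+x)T_{n,2}(x)=xM_{n,2}(x^2)+\widetilde M_{n,2}(x^2)$. Let $(a,b)$ be the $\mathcal{I}_n$-decomposition of $\widetilde M_{n,2}(x)$. Then $T_{n,2}(x)$ is Hurwitz stable for all $n\in\mathbb{N}$ and $b\ll a$. In particular, $M_{n,2}(x)$ and $\widetilde M_{n,2}(x)$ are alternatingly increasing for all $n\in\mathbb{N}$.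
   Context: $M_{n,2}$ and $\widetilde M_{n,2}$ are the interior-peak and left-peak generating polynomials on the dual set of Stirling permutations of order $n$; this is not needed for the statement. A polynomial is Hurwitz stable if it is identically zero or has no zeros with $\Re(x)>0$. For $p$ of degree at most $n$, $\mathcal{I}_n(p)(x)=x^np(1/x)$; the $\mathcal{I}_n$-decomposition of $p$ is the unique pair $(a,b)$ with $p=a+xb$, $\mathcal{I}_n(a)=a$ and $\mathcal{I}_{n-1}(b)=b$. For real-rooted real polynomials $f,g$ with zeros $\{r_i\}$, $\{s_j\}$ in decreasing order, $g\preceq f$ means either $\deg f=\deg g+1=d$ and $r_d\le s_{d-1}\le\cdots\le s_1\le r_1$, or $\deg f=\deg g=d$ and $s_d\le r_d\le\cdots\le s_1\le r_1$; $g\ll f$ means $g\preceq f$ with leading coefficients of the same sign, or $f\preceq g$ with leading coefficients of opposite sign; by convention $0\ll f$ and $f\ll0$ for real-rooted $f$. A polynomial $p=\sum_{j=0}^dp_jx^j$ of degree $d$ is alternatingly increasing if $0\le p_0\le p_d\le p_1\le p_{d-1}\le\cdots\le p_{\lfloor(d+1)/2\rfloor}$. *)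

theory Defs
  imports Complex_Main "HOL-Computational_Algebra.Computational_Algebra"
begin

primrec M2 :: "nat \<Rightarrow> real poly" where
  "M2 0 = 1"
| "M2 (Suc n) = [:1, 2 * real (Suc n) - 2:] * M2 n + [:0, 2:] * [:1, -1:] * pderiv (M2 n)"

primrec Mtilde2 :: "nat \<Rightarrow> real poly" where
  "Mtilde2 0 = 1"
| "Mtilde2 (Suc n) = [:0, 2 * real (Suc n) - 1:] * Mtilde2 n + [:0, 2:] * [:1, -1:] * pderiv (Mtilde2 n)"

text \<open>The division below is exact: see \<open>T2_eq\<close> below.\<close>

definition T2 :: "nat \<Rightarrow> real poly" where
  "T2 n = ([:0, 1:] * pcompose (M2 n) [:0, 0, 1:] + pcompose (Mtilde2 n) [:0, 0, 1:]) div [:1, 1:]"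

definition hurwitz_stable :: "complex poly \<Rightarrow> bool" where
  "hurwitz_stable p \<longleftrightarrow> p = 0 \<or> (\<forall>z. Re z > 0 \<longrightarrow> poly p z \<noteq> 0)"

text \<open>For \<open>degree p \<le> n\<close> this is the polynomial \<open>x ^ n * p (1 / x)\<close>: see \<open>poly_recip_poly\<close>.\<close>

definition recip_poly :: "nat \<Rightarrow> real poly \<Rightarrow> real poly" where
  "recip_poly n p = (\<Sum>i\<le>n. monom (coeff p i) (n - i))"

text \<open>For \<open>n = 0\<close> the condition on \<open>b\<close> reads \<open>b (1 / x) / x = b (x)\<close>, which only
  \<open>b = 0\<close> satisfies.  Existence and uniqueness are \<open>recip_decomposition_ex1\<close>.\<close>

definition recip_decomposition :: "nat \<Rightarrow> real poly \<Rightarrow> real poly \<Rightarrow> real poly \<Rightarrow> bool" where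
  "recip_decomposition n p a b \<longleftrightarrow>
     p = a + [:0, 1:] * b \<and>
     degree a \<le> n \<and> recip_poly n a = a \<and>
     (if n = 0 then b = 0 else degree b \<le> n - 1 \<and> recip_poly (n - 1) b = b)"

definition real_rooted :: "real poly \<Rightarrow> bool" where
  "real_rooted p \<longleftrightarrow> (\<forall>z. poly (map_poly complex_of_real p) z = 0 \<longrightarrow> z \<in> \<real>)"

text \<open>Real zeros listed with multiplicity in decreasing order, so that \<open>zeros_desc p ! i\<close> is the
  zero usually written with index \<open>i + 1\<close>.\<close>

definition zeros_desc :: "real poly \<Rightarrow> real list" where
  "zeros_desc p = rev (sorted_list_of_multiset (proots p))"

definition interlaces :: "real poly \<Rightarrow> real poly \<Rightarrow> bool" where
  "interlaces g f \<longleftrightarrow>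
     f \<noteq> 0 \<and> g \<noteq> 0 \<and> real_rooted f \<and> real_rooted g \<and>
     (let r = zeros_desc f; s = zeros_desc g; d = degree f in
        (d = degree g + 1 \<and> (\<forall>i. i + 1 < d \<longrightarrow> r ! (i + 1) \<le> s ! i \<and> s ! i \<le> r ! i)) \<or>
        (d = degree g \<and> (\<forall>i<d. s ! i \<le> r ! i) \<and> (\<forall>i. i + 1 < d \<longrightarrow> r ! (i + 1) \<le> s ! i)))"

definition interlaces_signed :: "real poly \<Rightarrow> real poly \<Rightarrow> bool" (infix "\<lless>" 50) where
  "g \<lless> f \<longleftrightarrow>
     (interlaces g f \<and> sgn (lead_coeff g) = sgn (lead_coeff f)) \<or>
     (interlaces f g \<and> sgn (lead_coeff g) = - sgn (lead_coeff f)) \<or>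
     (g = 0 \<and> real_rooted f) \<or>
     (f = 0 \<and> real_rooted g)"

definition alternatingly_increasing :: "real poly \<Rightarrow> bool" where
  "alternatingly_increasing p \<longleftrightarrow>
     (let d = degree p in
        0 \<le> coeff p 0 \<and>
        (\<forall>i. 2 * i + 1 \<le> d \<longrightarrow> coeff p i \<le> coeff p (d - i)) \<and>
        (\<forall>i. 2 * i + 2 \<le> d \<longrightarrow> coeff p (d - i) \<le> coeff p (i + 1)))"

lemma poly_1_eq: "poly (M2 n) 1 = poly (Mtilde2 n) 1"
  by (induction n) (simp_all add: algebra_simps)

lemma T2_eq:
  "[:1, 1:] * T2 n = [:0, 1:] * pcompose (M2 n) [:0, 0, 1:] + pcompose (Mtilde2 n) [:0, 0, 1:]"
proof -
  have "[:- (- 1), 1:] dvd [:0, 1:] * pcompose (M2 n) [:0, 0, 1:] + pcompose (Mtilde2 n) [:0, 0, 1:]"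
    by (subst poly_eq_0_iff_dvd [symmetric]) (simp add: poly_pcompose poly_1_eq)
  then show ?thesis
    unfolding T2_def by (simp only: minus_minus dvd_mult_div_cancel)
qed

lemma degree_Mtilde2: "degree (Mtilde2 n) \<le> n"
proof (induction n)
  case (Suc n)
  have "degree ([:0, 2 * real (Suc n) - 1:] * Mtilde2 n) \<le> Suc n"
    by (rule order_trans [OF degree_mult_le]) (use Suc in simp)
  moreover have "degree ([:0, 2:] * [:1, -1:] * pderiv (Mtilde2 n)) \<le> Suc n"
  proof (cases "degree (Mtilde2 n) = 0")
    case True
    then have "pderiv (Mtilde2 n) = 0" by (simp add: pderiv_eq_0_iff)
    then show ?thesis by simp
  next
    case False
    have "degree ([:0, 2:] * [:1, -1:] * pderiv (Mtilde2 n)) \<le> 2 + degree (pderiv (Mtilde2 n))"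
      by (rule order_trans [OF degree_mult_le]) simp
    then show ?thesis using Suc False by (simp add: degree_pderiv)
  qed
  ultimately show ?case by (simp only: Mtilde2.simps) (rule degree_add_le)
qed simp

lemma coeff_recip_poly: "coeff (recip_poly n p) i = (if i \<le> n then coeff p (n - i) else 0)"
proof -
  have "coeff (recip_poly n p) i = (\<Sum>j\<le>n. if j = n - i \<and> i \<le> n then coeff p j else 0)"
    unfolding recip_poly_def coeff_sum coeff_monom by (intro sum.cong) auto
  also have "\<dots> = (if i \<le> n then coeff p (n - i) else 0)"
    by (cases "i \<le> n") simp_all
  finally show ?thesis .
qed

lemma poly_recip_poly:
  assumes "degree p \<le> n" "x \<noteq> 0"
  shows "poly (recip_poly n p) x = x ^ n * poly p (1 / x)"
proof -
  have "poly (recip_poly n p) x = (\<Sum>i\<le>n. coeff p i * x ^ (n - i))"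
    by (simp add: recip_poly_def poly_sum poly_monom)
  also have "\<dots> = (\<Sum>i\<le>n. x ^ n * (coeff p i * (1 / x) ^ i))"
    using assms by (intro sum.cong) (simp_all add: power_diff power_divide)
  also have "\<dots> = x ^ n * (\<Sum>i\<le>n. coeff p i * (1 / x) ^ i)"
    by (simp add: sum_distrib_left)
  also have "(\<Sum>i\<le>n. coeff p i * (1 / x) ^ i) = poly p (1 / x)"
    unfolding poly_altdef using assms
    by (intro sum.mono_neutral_right) (auto simp: coeff_eq_0)
  finally show ?thesis .
qed

lemma recip_decomposition_coeff:
  "recip_decomposition n p a b \<longleftrightarrow>
     (\<forall>i. coeff p i = coeff a i + (if i = 0 then 0 else coeff b (i - 1))) \<and>
     (\<forall>i. coeff a i = (if i \<le> n then coeff a (n - i) else 0)) \<and>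
     (\<forall>i. coeff b i = (if i < n then coeff b (n - 1 - i) else 0))"
proof -
  have 1: "p = a + [:0, 1:] * b \<longleftrightarrow>
      (\<forall>i. coeff p i = coeff a i + (if i = 0 then 0 else coeff b (i - 1)))"
    by (simp add: poly_eq_iff coeff_pCons) (auto split: nat.splits simp: gr0_conv_Suc)
  have 2: "degree q \<le> m \<and> recip_poly m q = q \<longleftrightarrow>
      (\<forall>i. coeff q i = (if i \<le> m then coeff q (m - i) else 0))" for m q
  proof
    assume "\<forall>i. coeff q i = (if i \<le> m then coeff q (m - i) else 0)"
    then show "degree q \<le> m \<and> recip_poly m q = q"
      by (metis coeff_recip_poly degree_le not_le poly_eq_iff)
  qed (metis coeff_recip_poly)
  have 3: "(if n = 0 then b = 0 else degree b \<le> n - 1 \<and> recip_poly (n - 1) b = b) \<longleftrightarrow>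
      (\<forall>i. coeff b i = (if i < n then coeff b (n - 1 - i) else 0))"
  proof (cases "n = 0")
    case False
    then have "i \<le> n - 1 \<longleftrightarrow> i < n" for i by auto
    then show ?thesis using False 2 [of b "n - 1"] by simp
  qed (simp add: poly_eq_iff)
  show ?thesis unfolding recip_decomposition_def 1 3 using 2 [of a n] by blast
qed

lemma recip_decomposition_ex1:
  assumes "degree p \<le> n"
  shows "\<exists>!(a, b). recip_decomposition n p a b"
proof -
  define S where "S i = (\<Sum>j<i. coeff p j)" for i
  have S_Suc: "S (Suc i) = S i + coeff p i" for i by (simp add: S_def)
  define a where "a = (\<Sum>i\<le>n. monom (S (Suc i) + S (Suc n - i) - S (Suc n)) i)"
  define b where "b = (\<Sum>i<n. monom (S (Suc n) - S (n - i) - S (Suc i)) i)"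
  have ca: "coeff a i = (if i \<le> n then S (Suc i) + S (Suc n - i) - S (Suc n) else 0)" for i
    by (simp add: a_def coeff_sum)
  have cb: "coeff b i = (if i < n then S (Suc n) - S (n - i) - S (Suc i) else 0)" for i
    by (simp add: b_def coeff_sum)
  have "coeff p i = coeff a i + (if i = 0 then 0 else coeff b (i - 1))" for i
    using assms by (cases i) (auto simp: ca cb S_Suc coeff_eq_0 S_def [of 0])
  moreover have "coeff a i = (if i \<le> n then coeff a (n - i) else 0)" for i
    by (simp add: ca Suc_diff_le)
  moreover have "coeff b i = (if i < n then coeff b (n - 1 - i) else 0)" for i
    by (simp add: cb Suc_diff_Suc)
  ultimately have ex: "recip_decomposition n p a b"
    unfolding recip_decomposition_coeff by blast
  have uniq: "a1 = a2 \<and> b1 = b2"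
    if d1: "recip_decomposition n p a1 b1" and d2: "recip_decomposition n p a2 b2" for a1 b1 a2 b2
  proof -
    define u where "u i = coeff a1 i - coeff a2 i" for i
    define v where "v i = coeff b1 i - coeff b2 i" for i
    from d1 d2 have sum0: "u i + (if i = 0 then 0 else v (i - 1)) = 0" for i
      unfolding recip_decomposition_coeff u_def v_def by (smt (verit))
    have su: "u i = (if i \<le> n then u (n - i) else 0)" for i
      using d1 d2 unfolding recip_decomposition_coeff u_def by (smt (verit))
    have sv: "v i = (if i < n then v (n - 1 - i) else 0)" for i
      using d1 d2 unfolding recip_decomposition_coeff v_def by (smt (verit))
    have u0: "u i = 0" for i
    proof (induction i)
      case 0
      show ?case using sum0 [of 0] by simp
    next
      case (Suc i)
      show ?case
      proof (cases "i < n")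
        case True
        have "u (Suc i) = - v i" using sum0 [of "Suc i"] by simp
        also have "v i = v (n - 1 - i)" using sv [of i] True by simp
        also have "\<dots> = - u (n - i)" using sum0 [of "n - i"] True by simp
        also have "u (n - i) = u i" using su [of i] True by simp
        finally show ?thesis using Suc by simp
      next
        case False
        then show ?thesis using su [of "Suc i"] by simp
      qed
    qed
    moreover have "v i = 0" for i using sum0 [of "Suc i"] u0 [of "Suc i"] by simp
    ultimately show ?thesis by (simp add: u_def v_def poly_eq_iff)
  qed
  show ?thesis using ex uniq by (intro ex1I [of _ "(a, b)"]) auto
qed

end

theory Submission
  imports Defs
begin


text \<open>\<open>F\<^sub>n = (1 + x) T\<^sub>n\<close> satisfies \<open>F\<^sub>n\<^sub>+\<^sub>1 = (2n + 1) x\<^sup>2 F\<^sub>n + x (1 - x\<^sup>2) F\<^sub>n'\<close>. Writing \<open>F\<^sub>n'/F\<^sub>n\<close> as a sum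
  over the zeros shows that \<open>F\<^sub>n\<^sub>+\<^sub>1 / (x F\<^sub>n)\<close> has positive real part for \<open>Re x \<ge> 0\<close>, \<open>x \<noteq> 0\<close>; hence all
  zeros of \<open>T\<^sub>n\<close> other than \<open>0\<close> lie in the open left half-plane. For \<open>n \<ge> 1\<close>, reversal of coefficients
  exchanges \<open>M\<^sub>n\<close> and its companion, so \<open>M\<^sub>n = a + b\<close> and \<open>T\<^sub>n(x) = a(x\<^sup>2) + x b(x\<^sup>2)\<close>. The
  Hermite-Biehler argument applies for \<open>n \<ge> 2\<close>: \<open>|T\<^sub>n(-x)| < |T\<^sub>n(x)|\<close> for \<open>Re x > 0\<close> makes \<open>a\<close> and \<open>b\<close>
  real-rooted, and \<open>Re (T\<^sub>n'/T\<^sub>n) > 0\<close> on the imaginary axis gives the signs that force interlacing.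
  The coefficient inequalities follow by induction directly from the recurrence for \<open>M\<^sub>n\<close>.\<close>

section \<open>Coefficients\<close>

lemma coeff_M2_Suc:
  "coeff (M2 (Suc n)) k =
     (2 * real k + 1) * coeff (M2 n) k
     + (if k = 0 then 0 else (2 * real n + 2 - 2 * real k) * coeff (M2 n) (k - 1))"
  by (cases k; cases "k - 1")
    (auto simp: coeff_pCons coeff_pderiv algebra_simps split: nat.splits)

lemma coeff_Mtilde2_Suc:
  "coeff (Mtilde2 (Suc n)) k =
     2 * real k * coeff (Mtilde2 n) k
     + (if k = 0 then 0 else (2 * real n + 3 - 2 * real k) * coeff (Mtilde2 n) (k - 1))"
  by (cases k; cases "k - 1")
    (auto simp: coeff_pCons coeff_pderiv algebra_simps split: nat.splits)

lemma coeff_M2_Suc_eq_0: "n < k \<Longrightarrow> coeff (M2 (Suc n)) k = 0"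
proof (induction n arbitrary: k)
  case 0
  then show ?case by (auto simp add: coeff_M2_Suc simp del: M2.simps(2))
next
  case (Suc n)
  then show ?case by (auto simp add: coeff_M2_Suc [of "Suc n"] simp del: M2.simps(2))
qed

lemma coeff_M2_0 [simp]: "coeff (M2 n) 0 = 1"
  by (induction n) (simp_all add: coeff_M2_Suc del: M2.simps(2))

lemma coeff_M2_top: "coeff (M2 (Suc n)) n = 2 ^ n"
proof (induction n)
  case (Suc n)
  then show ?case
    by (simp add: coeff_M2_Suc [of "Suc n"] coeff_M2_Suc_eq_0 del: M2.simps(2))
qed simp

text \<open>Replacing \<open>k\<close> by \<open>Suc n - k\<close> interchanges the two weights in
  \<open>coeff_M2_Suc\<close> and turns them into those of \<open>coeff_Mtilde2_Suc\<close>, so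
  reversal carries one recurrence to the other.\<close>

lemma coeff_Mtilde2_Suc_eq:
  "k \<le> Suc n \<Longrightarrow> coeff (Mtilde2 (Suc n)) k = coeff (M2 (Suc n)) (Suc n - k)"
proof (induction n arbitrary: k)
  case 0
  then have "k = 0 \<or> k = 1" by auto
  then show ?case
    by (auto simp add: coeff_Mtilde2_Suc coeff_M2_Suc simp del: M2.simps(2) Mtilde2.simps(2))
next
  case (Suc n)
  have top: "coeff (Mtilde2 (Suc n)) (Suc (Suc n)) = 0"
    using degree_Mtilde2 [of "Suc n"] by (intro coeff_eq_0) simp
  consider "k = 0" | "k = Suc (Suc n)" | j where "k = Suc j" "j \<le> n"
    using Suc.prems by (metis le_SucE not0_implies_Suc Suc_le_mono)
  then show ?case
  proof cases
    case 1
    then show ?thesis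
      by (simp add: coeff_Mtilde2_Suc [of "Suc n"] coeff_M2_Suc_eq_0
          del: M2.simps(2) Mtilde2.simps(2))
  next
    case 2
    then show ?thesis
      by (simp add: coeff_Mtilde2_Suc [of "Suc n"] top Suc.IH del: M2.simps(2) Mtilde2.simps(2))
  next
    case (3 j)
    have "coeff (Mtilde2 (Suc n)) (Suc j) = coeff (M2 (Suc n)) (n - j)"
      "coeff (Mtilde2 (Suc n)) j = coeff (M2 (Suc n)) (Suc n - j)"
      using Suc.IH [of "Suc j"] Suc.IH [of j] 3 by simp_all
    then show ?thesis
      using 3
      by (simp add: coeff_Mtilde2_Suc [of "Suc n"] coeff_M2_Suc [of "Suc n"] Suc_diff_le of_nat_diff
          algebra_simps del: M2.simps(2) Mtilde2.simps(2))
  qed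
qed

text \<open>With c_i the coefficients of \<open>M2 (Suc n)\<close>, the two families form the chain
  c_(n+1) = 0 \<le> c_0 \<le> c_n \<le> c_1 \<le> c_(n-1) \<le> ... They are proved jointly because
  the induction step of each uses both.\<close>

lemma coeff_M2_chain:
  "(\<forall>i. 2 * i \<le> n \<longrightarrow> coeff (M2 (Suc n)) i \<le> coeff (M2 (Suc n)) (n - i)) \<and>
   (\<forall>i. 2 * i \<le> Suc n \<longrightarrow> coeff (M2 (Suc n)) (Suc n - i) \<le> coeff (M2 (Suc n)) i)"
proof (induction n)
  case 0
  have "0 \<le> coeff (M2 (Suc 0)) i" for i
    by (cases i) (simp_all add: coeff_M2_Suc_eq_0 del: M2.simps(2))
  then show ?case by (auto simp: coeff_M2_Suc_eq_0 simp del: M2.simps(2))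
next
  case (Suc n)
  define m where "m = coeff (M2 (Suc n))"
  define m' where "m' = coeff (M2 (Suc (Suc n)))"
  have m'_0: "m' 0 = 1" and m_0: "m 0 = 1" by (simp_all only: m'_def m_def coeff_M2_0)
  have m'_Suc: "m' (Suc k) = (2 * real k + 3) * m (Suc k) + (2 * real n + 2 - 2 * real k) * m k" for k
    by (simp add: m_def m'_def coeff_M2_Suc [of "Suc n"] algebra_simps del: M2.simps(2))
  have lo: "m i \<le> m (n - i)" if "2 * i \<le> n" for i
    using Suc that by (simp add: m_def)
  have hi: "m (Suc n - i) \<le> m i" if "2 * i \<le> Suc n" for i
    using Suc that by (simp add: m_def)
  have "m' i \<le> m' (Suc n - i)" if i: "2 * i \<le> Suc n" for i
  proof (cases "2 * i = Suc n")
    case True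
    then have "Suc n - i = i" by simp
    then show ?thesis by simp
  next
    case False
    show ?thesis
    proof (cases i)
      case 0
      have "m (Suc n) = 0" by (simp add: m_def coeff_M2_Suc_eq_0 del: M2.simps(2))
      moreover have "1 \<le> m n" using lo [of 0] m_0 by simp
      ultimately show ?thesis using 0 by (simp add: m'_Suc m'_0)
    next
      case (Suc j)
      have k: "n - Suc j = n - i" "Suc (n - Suc j) = n - j" "2 * j \<le> n" "j < n" "2 * Suc j \<le> n"
        using i False Suc by auto
      have c1: "m j \<le> m (n - j)" using lo k by simp
      have c2: "m (n - j) \<le> m (Suc j)" using hi [of "Suc j"] i Suc k by simp
      have c3: "m (Suc j) \<le> m (n - Suc j)" by (rule lo) (rule k(5))
      have r: "real (n - Suc j) = real n - real j - 1" using k by (simp add: of_nat_diff)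
      have "m' (Suc n - i) = m' (Suc (n - Suc j))" using k Suc by simp
      also have "\<dots> = (2 * real n - 2 * real j + 1) * m (n - j)
          + (2 * real j + 4) * m (n - Suc j)"
        unfolding m'_Suc unfolding r k(2) by (simp only: algebra_simps)
      \<comment> \<open>The weights pair off up to one spare copy of
        \<open>m (n - Suc j) - m j\<close>, which is nonnegative by the chain \<open>c1\<close>,
        \<open>c2\<close>, \<open>c3\<close>.\<close>
      finally have *: "m' (Suc n - i) - m' i =
          (2 * real n - 2 * real j + 1) * (m (n - j) - m j)
          + (2 * real j + 3) * (m (n - Suc j) - m (Suc j)) + (m (n - Suc j) - m j)"
        using Suc by (simp add: m'_Suc algebra_simps)
      have "0 \<le> (2 * real n - 2 * real j + 1) * (m (n - j) - m j)"
        "0 \<le> (2 * real j + 3) * (m (n - Suc j) - m (Suc j))"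
        using c1 c3 k by (auto intro!: mult_nonneg_nonneg)
      then show ?thesis using * c1 c2 c3 by linarith
    qed
  qed
  moreover have "m' (Suc (Suc n) - i) \<le> m' i" if i: "2 * i \<le> Suc (Suc n)" for i
  proof (cases "2 * i = Suc (Suc n)")
    case True
    then have "Suc (Suc n) - i = i" by simp
    then show ?thesis by simp
  next
    case False
    show ?thesis
    proof (cases i)
      case 0
      have "m' (Suc (Suc n)) = 0"
        unfolding m'_def by (intro coeff_M2_Suc_eq_0) simp
      then show ?thesis using 0 by (simp add: m'_0)
    next
      case (Suc j)
      have k: "2 * j < n" "2 * Suc j \<le> Suc n" "Suc (n - j) = Suc n - j" using i False Suc by auto
      have c1: "m (n - j) \<le> m (Suc j)" using hi [of "Suc j"] k by simp
      have c3: "m j \<le> m (n - j)" "m (Suc n - j) \<le> m j" using lo [of j] hi [of j] k by auto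
      have r: "real (n - j) = real n - real j" using k by (simp add: of_nat_diff)
      have "m' (Suc (Suc n) - i) = m' (Suc (n - j))" using k Suc by simp
      also have "\<dots> = (2 * real n - 2 * real j + 3) * m (Suc n - j)
          + (2 * real j + 2) * m (n - j)"
        unfolding m'_Suc unfolding r k(3) by (simp only: algebra_simps)
      \<comment> \<open>Same pairing; the spare copy is nonnegative because
        \<open>m (Suc n - j) \<le> m j \<le> m (n - j) \<le> m (Suc j)\<close>.\<close>
      finally have *: "m' i - m' (Suc (Suc n) - i) =
          (2 * real n - 2 * real j + 2) * (m j - m (Suc n - j))
          + (2 * real j + 2) * (m (Suc j) - m (n - j)) + (m (Suc j) - m (Suc n - j))"
        using Suc by (simp add: m'_Suc algebra_simps)
      have "0 \<le> (2 * real n - 2 * real j + 2) * (m j - m (Suc n - j))"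
        "0 \<le> (2 * real j + 2) * (m (Suc j) - m (n - j))"
        using c1 c3 k by (auto intro!: mult_nonneg_nonneg)
      then show ?thesis using * c1 c3 by linarith
    qed
  qed
  ultimately show ?case unfolding m_def m'_def by blast
qed

section \<open>Degrees and the alternatingly increasing property\<close>

lemma degree_M2_Suc: "degree (M2 (Suc n)) = n"
proof (rule antisym)
  show "degree (M2 (Suc n)) \<le> n"
    by (rule degree_le) (auto simp: coeff_M2_Suc_eq_0 simp del: M2.simps(2))
  show "n \<le> degree (M2 (Suc n))"
    by (rule le_degree) (simp add: coeff_M2_top del: M2.simps(2))
qed

lemma degree_Mtilde2_Suc: "degree (Mtilde2 (Suc n)) = Suc n"
proof (rule antisym [OF degree_Mtilde2])
  show "Suc n \<le> degree (Mtilde2 (Suc n))"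
    by (rule le_degree)
      (simp add: coeff_Mtilde2_Suc_eq del: M2.simps(2) Mtilde2.simps(2))
qed

lemma alternatingly_increasing_M2: "alternatingly_increasing (M2 n)"
proof (cases n)
  case 0
  then show ?thesis by (simp add: alternatingly_increasing_def)
next
  case (Suc k)
  have "coeff (M2 (Suc k)) (k - i) \<le> coeff (M2 (Suc k)) (i + 1)" if "2 * i + 2 \<le> k" for i
    using conjunct2 [OF coeff_M2_chain [of k], rule_format, of "Suc i"] that by simp
  then show ?thesis
    using coeff_M2_chain [of k] Suc
    by (simp add: alternatingly_increasing_def degree_M2_Suc Let_def del: M2.simps(2))
qed

text \<open>Under reversal in degree \<open>Suc k\<close> the two families of
  \<open>coeff_M2_chain\<close> exchange roles.\<close>

lemma alternatingly_increasing_Mtilde2: "alternatingly_increasing (Mtilde2 n)"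
proof (cases n)
  case 0
  then show ?thesis by (simp add: alternatingly_increasing_def)
next
  case (Suc k)
  have "coeff (Mtilde2 (Suc k)) i \<le> coeff (Mtilde2 (Suc k)) (Suc k - i)" if "2 * i \<le> k" for i
    using coeff_M2_chain [of k] that
    by (simp add: coeff_Mtilde2_Suc_eq del: M2.simps(2) Mtilde2.simps(2))
  moreover have "coeff (Mtilde2 (Suc k)) (Suc k - i) \<le> coeff (Mtilde2 (Suc k)) (Suc i)"
    if "2 * i + 1 \<le> k" for i
    using coeff_M2_chain [of k] that
    by (simp add: coeff_Mtilde2_Suc_eq del: M2.simps(2) Mtilde2.simps(2))
  moreover have "coeff (Mtilde2 (Suc k)) 0 = 0"
    by (simp add: coeff_Mtilde2_Suc_eq coeff_M2_Suc_eq_0 del: M2.simps(2) Mtilde2.simps(2))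
  ultimately show ?thesis
    using Suc
    by (simp add: alternatingly_increasing_def degree_Mtilde2_Suc Let_def del: Mtilde2.simps(2))
qed

text \<open>Reversal in degree \<open>Suc n\<close> turns \<open>Mtilde2 (Suc n)\<close> into
  \<open>M2 (Suc n)\<close>; it fixes \<open>a\<close> and sends x b to b, because \<open>b\<close>
  is symmetric in degree \<open>n\<close>.\<close>

lemma M2_decomposition:
  assumes "recip_decomposition (Suc n) (Mtilde2 (Suc n)) a b"
  shows "M2 (Suc n) = a + b"
proof (rule poly_eqI)
  fix i
  have p: "coeff (Mtilde2 (Suc n)) k = coeff a k + (if k = 0 then 0 else coeff b (k - 1))"
    and a: "coeff a k = (if k \<le> Suc n then coeff a (Suc n - k) else 0)"
    and b: "coeff b k = (if k < Suc n then coeff b (n - k) else 0)" for k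
    using assms unfolding recip_decomposition_coeff by simp_all
  show "coeff (M2 (Suc n)) i = coeff (a + b) i"
  proof (cases "i \<le> Suc n")
    case True
    then have "coeff (M2 (Suc n)) i = coeff (Mtilde2 (Suc n)) (Suc n - i)"
      by (simp add: coeff_Mtilde2_Suc_eq del: M2.simps(2) Mtilde2.simps(2))
    also have "\<dots> = coeff a (Suc n - i) + (if Suc n - i = 0 then 0 else coeff b (Suc n - i - 1))"
      by (rule p)
    also have "Suc n - i - 1 = n - i" by simp
    also have "coeff a (Suc n - i) = coeff a i" using a [of i] True by simp
    also have "(if Suc n - i = 0 then 0 else coeff b (n - i)) = coeff b i"
      using b [of i] True by auto
    finally show ?thesis by simp
  next
    case False
    then show ?thesis
      using a [of i] b [of i] by (simp add: coeff_M2_Suc_eq_0 del: M2.simps(2))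
  qed
qed

text \<open>With y = x^2, x M(y) + (a + y b)(y) = x (a + b)(y) + (a + y b)(y) = (1 + x) (a(y) + x
  b(y)); cancel 1 + x. Thus \<open>a\<close> and \<open>b\<close> are the even and odd parts of
  \<open>T2\<close>.\<close>

lemma T2_decomposition:
  assumes "recip_decomposition (Suc n) (Mtilde2 (Suc n)) a b"
  shows "T2 (Suc n) = pcompose a [:0, 0, 1:] + [:0, 1:] * pcompose b [:0, 0, 1:]"
proof -
  have "Mtilde2 (Suc n) = a + [:0, 1:] * b"
    using assms unfolding recip_decomposition_def by blast
  then have "[:1, 1:] * T2 (Suc n) =
      [:1, 1:] * (pcompose a [:0, 0, 1:] + [:0, 1:] * pcompose b [:0, 0, 1:])"
    unfolding T2_eq M2_decomposition [OF assms]
    by (simp add: pcompose_add pcompose_mult pcompose_pCons algebra_simps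
        del: M2.simps(2) Mtilde2.simps(2))
  then show ?thesis
    by (metis mult_left_cancel one_neq_zero pCons_eq_0_iff)
qed

section \<open>Zeros in the left half-plane\<close>

abbreviation cpoly :: "real poly \<Rightarrow> complex poly" where
  "cpoly \<equiv> map_poly complex_of_real"

lemma cpoly_add: "cpoly (p + q) = cpoly p + cpoly q"
  by (rule poly_eqI) (simp add: coeff_map_poly)

lemma cpoly_mult: "cpoly (p * q) = cpoly p * cpoly q"
  by (rule poly_eqI) (simp add: coeff_map_poly coeff_mult)

lemma cpoly_pderiv: "cpoly (pderiv p) = pderiv (cpoly p)"
  by (rule poly_eqI) (simp add: coeff_map_poly coeff_pderiv)

lemma cpoly_pcompose: "cpoly (pcompose p q) = pcompose (cpoly p) (cpoly q)"
  by (induction p) (simp_all add: map_poly_pCons pcompose_pCons cpoly_add cpoly_mult)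

lemma poly_cpoly_of_real: "poly (cpoly p) (of_real x) = of_real (poly p x)"
  by (induction p) (simp_all add: map_poly_pCons)

lemma poly_cpoly_cnj: "poly (cpoly p) (cnj z) = cnj (poly (cpoly p) z)"
  by (induction p) (simp_all add: map_poly_pCons)

section \<open>Products and sums over complex zeros\<close>

lemma poly_eq_prod_proots:
  fixes p :: "complex poly"
  shows "poly p z = lead_coeff p * (\<Prod>r\<in>#proots p. z - r)"
proof -
  have "poly (\<Prod>r\<in>#A. [:-r, 1:]) z = (\<Prod>r\<in>#A. z - r)" for A :: "complex multiset"
    by (induction A) (simp_all add: algebra_simps)
  then show ?thesis
    using arg_cong [OF complex_poly_decompose_multiset [of p], of "\<lambda>q. poly q z"] by simp
qed

lemma pderiv_over_poly:
  fixes p :: "complex poly"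
  assumes "poly p z \<noteq> 0"
  shows "poly (pderiv p) z / poly p z = (\<Sum>r\<in>#proots p. 1 / (z - r))"
proof -
  have *: "poly (pderiv (\<Prod>r\<in>#A. [:-r, 1:])) z =
      poly (\<Prod>r\<in>#A. [:-r, 1:]) z * (\<Sum>r\<in>#A. 1 / (z - r))"
    if "z \<notin># A" for A :: "complex multiset"
    using that
  proof (induction A)
    case empty
    show ?case by (simp add: pderiv_1)
  next
    case (add r A)
    then have "z - r \<noteq> 0" by auto
    with add show ?case
      unfolding image_mset_add_mset prod_mset.add_mset sum_mset.add_mset pderiv_mult
      by (simp add: pderiv_pCons field_simps)
  qed
  from assms have "p \<noteq> 0" by auto
  define q where "q = (\<Prod>r\<in>#proots p. [:-r, 1:])"
  have pq: "p = smult (lead_coeff p) q"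
    unfolding q_def by (rule complex_poly_decompose_multiset [symmetric])
  have "poly (pderiv p) z = lead_coeff p * poly (pderiv q) z"
    by (subst pq) (simp add: pderiv_smult)
  also have "\<dots> = lead_coeff p * poly q z * (\<Sum>r\<in>#proots p. 1 / (z - r))"
    using * [of "proots p"] assms \<open>p \<noteq> 0\<close> by (simp add: q_def)
  also have "lead_coeff p * poly q z = poly p z"
    by (subst (3) pq) simp
  finally show ?thesis using assms by simp
qed

lemma sum_mset_pos:
  fixes f :: "'a \<Rightarrow> real"
  assumes "\<And>x. x \<in># A \<Longrightarrow> 0 \<le> f x" "y \<in># A" "0 < f y"
  shows "0 < (\<Sum>x\<in>#A. f x)"
proof -
  obtain B where A: "A = add_mset y B" using assms(2) by (metis multi_member_split)
  have "\<forall>x\<in>#B. 0 \<le> f x" using assms(1) A by auto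
  then have "0 \<le> (\<Sum>x\<in>#B. f x)" by (induction B) auto
  then show ?thesis using assms(3) A by simp
qed

lemma Re_sum_mset: "Re (\<Sum>x\<in>#A. f x) = (\<Sum>x\<in>#A. Re (f x))"
  by (induction A) simp_all

lemma Re_divide_eq: "Re (w / z) = Re (w * cnj z) / (cmod z)\<^sup>2"
  by (simp add: Re_divide cmod_power2)

text \<open>A zero \<open>w\<close> contributes Re (1 / (z - w)) = (Re z - Re w) / |z - w|^2, which
  is nonnegative, and positive for \<open>r\<close>.\<close>

lemma Re_pderiv_over_poly_pos:
  fixes p :: "complex poly"
  assumes nz: "poly p z \<noteq> 0" and z: "0 \<le> Re z"
    and roots: "\<And>w. poly p w = 0 \<Longrightarrow> Re w \<le> 0"
    and r: "poly p r = 0" "Re r < 0"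
  shows "0 < Re (poly (pderiv p) z / poly p z)"
proof -
  have "p \<noteq> 0" using nz by auto
  have "0 < (\<Sum>w\<in>#proots p. Re (1 / (z - w)))"
  proof (rule sum_mset_pos)
    show "0 \<le> Re (1 / (z - w))" if "w \<in># proots p" for w
      using that z roots [of w] \<open>p \<noteq> 0\<close> by (simp add: Re_divide_eq)
    show "r \<in># proots p" using r \<open>p \<noteq> 0\<close> by simp
    have "z \<noteq> r" using r nz by auto
    then show "0 < Re (1 / (z - r))" using r z by (simp add: Re_divide_eq)
  qed
  then show ?thesis by (simp only: pderiv_over_poly [OF nz] Re_sum_mset)
qed

text \<open>Each zero \<open>w\<close> contributes \<open>z + (1 - z\<^sup>2) / (z - w) = (1 - z w) / (z - w)\<close>, whose real part
  is \<open>(Re z (1 + |w|\<^sup>2) - Re w (1 + |z|\<^sup>2)) / |z - w|\<^sup>2\<close>.\<close>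

lemma Re_step_pos:
  fixes p :: "complex poly"
  assumes nz: "poly p z \<noteq> 0" and z: "0 \<le> Re z" and d: "degree p \<le> d"
    and roots: "\<And>w. poly p w = 0 \<Longrightarrow> Re w \<le> 0"
    and r: "poly p r = 0" "Re r < 0"
  shows "0 < Re (of_nat d * z + (1 - z\<^sup>2) * (poly (pderiv p) z / poly p z))"
proof -
  have "p \<noteq> 0" using nz by auto
  define g where "g w = (1 - z * w) / (z - w)" for w
  have Re_g: "Re (g w) = (Re z * (1 + (cmod w)\<^sup>2) - Re w * (1 + (cmod z)\<^sup>2)) / (cmod (z - w))\<^sup>2" for w
    unfolding g_def Re_divide_eq cmod_power2
    by (rule arg_cong2 [where f = "(/)"]) (simp_all add: algebra_simps power2_eq_square)
  have "0 < (\<Sum>w\<in>#proots p. Re (g w))"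
  proof (rule sum_mset_pos)
    show "0 \<le> Re (g w)" if "w \<in># proots p" for w
    proof -
      have "Re w \<le> 0" using that roots \<open>p \<noteq> 0\<close> by simp
      then have "Re w * (1 + (cmod z)\<^sup>2) \<le> 0" by (intro mult_nonpos_nonneg) auto
      moreover have "0 \<le> Re z * (1 + (cmod w)\<^sup>2)" using z by (intro mult_nonneg_nonneg) auto
      ultimately show ?thesis unfolding Re_g by (intro divide_nonneg_nonneg) auto
    qed
    show "r \<in># proots p" using r \<open>p \<noteq> 0\<close> by simp
    have "z \<noteq> r" using r nz by auto
    moreover have "Re r * (1 + (cmod z)\<^sup>2) < 0"
      using r by (intro mult_neg_pos) (auto intro: add_pos_nonneg)
    moreover have "0 \<le> Re z * (1 + (cmod r)\<^sup>2)" using z by (intro mult_nonneg_nonneg) auto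
    ultimately show "0 < Re (g r)" unfolding Re_g by (intro divide_pos_pos) auto
  qed
  also have "(\<Sum>w\<in>#proots p. Re (g w)) = Re (\<Sum>w\<in>#proots p. z + (1 - z\<^sup>2) * (1 / (z - w)))"
  proof -
    have "g w = z + (1 - z\<^sup>2) * (1 / (z - w))" if "w \<in># proots p" for w
    proof -
      have "z - w \<noteq> 0" using that nz \<open>p \<noteq> 0\<close> by auto
      then show ?thesis by (simp add: g_def field_simps power2_eq_square)
    qed
    then show ?thesis unfolding Re_sum_mset by (intro arg_cong [where f = sum_mset] image_mset_cong) simp
  qed
  also have "(\<Sum>w\<in>#proots p. z + (1 - z\<^sup>2) * (1 / (z - w))) =
      of_nat (degree p) * z + (1 - z\<^sup>2) * (poly (pderiv p) z / poly p z)"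
    unfolding sum_mset.distrib sum_mset_distrib_left [symmetric] pderiv_over_poly [OF nz]
    by (simp add: size_proots_complex)
  \<comment> \<open>Passing from \<open>degree p\<close> to \<open>d\<close> adds a nonnegative
    multiple of \<open>Re z\<close>.\<close>
  also have "Re \<dots> \<le> Re (of_nat d * z + (1 - z\<^sup>2) * (poly (pderiv p) z / poly p z))"
    using d z by (simp add: mult_right_mono)
  finally show ?thesis .
qed

text \<open>Real coefficients give |p(-z)| = |p(-cnj z)|. The point \<open>- cnj z\<close> mirrors
  \<open>z\<close> in the imaginary axis, so it is no farther from any zero than \<open>z\<close>
  is, and strictly closer to \<open>r\<close>.\<close>

lemma cmod_poly_minus_less:
  assumes nz: "poly (cpoly p) z \<noteq> 0" and z: "0 < Re z"
    and roots: "\<And>w. poly (cpoly p) w = 0 \<Longrightarrow> Re w \<le> 0"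
    and r: "poly (cpoly p) r = 0" "Re r < 0"
  shows "cmod (poly (cpoly p) (- z)) < cmod (poly (cpoly p) z)"
proof -
  define q where "q = cpoly p"
  have "q \<noteq> 0" using nz by (auto simp: q_def)
  have dist: "(cmod (z - w))\<^sup>2 - (cmod (- cnj z - w))\<^sup>2 = - 4 * Re z * Re w" for w
    unfolding cmod_power2 by (simp add: power2_eq_square algebra_simps)
  have le: "cmod (- cnj z - w) \<le> cmod (z - w)" if "Re w \<le> 0" for w
    using dist [of w] mult_nonneg_nonpos [of "Re z" "Re w"] that z
    by (intro power2_le_imp_le [OF _ norm_ge_zero]) linarith
  have nonneg: "0 \<le> (\<Prod>w\<in>#A. cmod (- cnj z - w))" for A by (induction A) simp_all
  have mono: "(\<Prod>w\<in>#A. cmod (- cnj z - w)) \<le> (\<Prod>w\<in>#A. cmod (z - w))"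
    if "\<forall>w\<in>#A. Re w \<le> 0" for A
    using that
  proof (induction A)
    case (add w A)
    then show ?case
      unfolding image_mset_add_mset prod_mset.add_mset by (intro mult_mono le nonneg) simp_all
  qed simp
  obtain B where B: "proots q = add_mset r B"
    using r \<open>q \<noteq> 0\<close> by (metis multi_member_split mem_Collect_eq q_def set_count_proots)
  have lt: "cmod (- cnj z - r) < cmod (z - r)"
    using dist [of r] mult_pos_neg [of "Re z" "Re r"] r z
    by (intro power2_less_imp_less [OF _ norm_ge_zero]) linarith
  have cmod_q: "cmod (poly q u) = cmod (lead_coeff q) * (cmod (u - r) * (\<Prod>w\<in>#B. cmod (u - w)))" for u
  proof -
    have "cmod (\<Prod>w\<in>#A. u - w) = (\<Prod>w\<in>#A. cmod (u - w))" for A :: "complex multiset"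
      by (induction A) (simp_all add: norm_mult)
    then show ?thesis by (subst poly_eq_prod_proots) (simp add: B norm_mult)
  qed
  \<comment> \<open>Strictness at \<open>r\<close> survives multiplication only if the remaining
    factors are nonzero at \<open>z\<close>.\<close>
  have posB: "0 < (\<Prod>w\<in>#B. cmod (z - w))"
  proof -
    have "(\<Prod>w\<in>#B. cmod (z - w)) \<noteq> 0" using cmod_q [of z] nz by (metis mult_zero_right norm_eq_zero q_def)
    moreover have "0 \<le> (\<Prod>w\<in>#B. cmod (z - w))" by (induction B) auto
    ultimately show ?thesis by linarith
  qed
  have B_nonpos: "\<forall>w\<in>#B. Re w \<le> 0"
  proof
    fix w assume "w \<in># B"
    then have "w \<in># proots q" by (simp add: B)
    then show "Re w \<le> 0" using roots \<open>q \<noteq> 0\<close> by (simp add: q_def)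
  qed
  have "cmod (- cnj z - r) * (\<Prod>w\<in>#B. cmod (- cnj z - w)) < cmod (z - r) * (\<Prod>w\<in>#B. cmod (z - w))"
    using mult_left_mono [OF mono [OF B_nonpos] norm_ge_zero] mult_strict_right_mono [OF lt posB]
    by (rule le_less_trans)
  then have "cmod (poly q (- cnj z)) < cmod (poly q z)"
    unfolding cmod_q using \<open>q \<noteq> 0\<close> by simp
  moreover have "cmod (poly q (- z)) = cmod (poly q (- cnj z))"
    using poly_cpoly_cnj [of p "- z"] by (simp add: q_def)
  ultimately show ?thesis by (simp add: q_def)
qed

text \<open>\<open>F = (1 + x) T\<close> satisfies a simpler recurrence than \<open>T\<close>, and its zero at \<open>-1\<close> makes
  the inequality of \<open>Re_step_pos\<close> strict.\<close>

lemma F_Suc: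
  "[:1, 1:] * T2 (Suc n) =
     [:0, 0, 2 * real n + 1:] * ([:1, 1:] * T2 n) + [:0, 1, 0, -1:] * pderiv ([:1, 1:] * T2 n)"
proof -
  have "poly ([:1, 1:] * T2 (Suc n)) x = poly ([:0, 0, 2 * real n + 1:] * ([:1, 1:] * T2 n)
      + [:0, 1, 0, -1:] * pderiv ([:1, 1:] * T2 n)) x" for x
    unfolding T2_eq
    by (simp add: poly_pcompose pderiv_pcompose pderiv_add pderiv_mult pderiv_pCons algebra_simps
        power2_eq_square)
  then show ?thesis by (intro poly_ext)
qed

text \<open>The bound equals the factor \<open>2 * n + 1\<close> in \<open>F_Suc\<close>, as
  \<open>Re_step_pos\<close> demands of its \<open>d\<close>.\<close>

lemma degree_F: "degree ([:1, 1:] * T2 n) \<le> 2 * n + 1"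
proof -
  have "degree (M2 n) \<le> n" by (cases n) (simp_all add: degree_M2_Suc del: M2.simps(2))
  then have "degree ([:0, 1:] * pcompose (M2 n) [:0, 0, 1:]) \<le> 2 * n + 1"
    by (intro order_trans [OF degree_mult_le]) (simp add: degree_pcompose)
  moreover have "degree (pcompose (Mtilde2 n) [:0, 0, 1:]) \<le> 2 * n + 1"
    using degree_Mtilde2 [of n] by (simp add: degree_pcompose)
  ultimately show ?thesis unfolding T2_eq by (rule degree_add_le)
qed

lemma F_roots: "poly (cpoly ([:1, 1:] * T2 n)) z = 0 \<Longrightarrow> z = 0 \<or> Re z < 0"
proof (induction n arbitrary: z)
  case 0
  have "[:1, 1:] * T2 0 = [:1, 1:]" by (simp only: T2_eq) (simp add: pcompose_pCons one_pCons)
  then have "z = -1" using 0 by (simp add: map_poly_pCons add_eq_0_iff del: mult_pCons_left)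
  then show ?case by simp
next
  case (Suc n)
  define p where "p = cpoly ([:1, 1:] * T2 n)"
  \<comment> \<open>The factor \<open>z\<close> accounts for the exceptional zero \<open>0\<close>;
    the other factor, divided by \<open>poly p z\<close>, is the quantity of
    \<open>Re_step_pos\<close>.\<close>
  have step: "poly (cpoly ([:1, 1:] * T2 (Suc n))) z =
      z * ((2 * of_nat n + 1) * z * poly p z + (1 - z\<^sup>2) * poly (pderiv p) z)"
    unfolding F_Suc cpoly_add cpoly_mult [of _ "[:1, 1:] * T2 n"] cpoly_mult [of _ "pderiv _"]
      cpoly_pderiv p_def
    by (simp add: map_poly_pCons algebra_simps power2_eq_square del: mult_pCons_left)
  show ?case
  proof (rule ccontr)
    assume "\<not> (z = 0 \<or> Re z < 0)"
    then have z: "z \<noteq> 0" "0 \<le> Re z" by auto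
    have nz: "poly p z \<noteq> 0" using Suc.IH [of z] z by (auto simp: p_def)
    have "0 < Re (of_nat (2 * n + 1) * z + (1 - z\<^sup>2) * (poly (pderiv p) z / poly p z))"
    proof (rule Re_step_pos [OF nz z(2)])
      show "degree p \<le> 2 * n + 1"
        using degree_F [of n] by (simp add: p_def degree_map_poly del: mult_pCons_left)
      show "Re w \<le> 0" if "poly p w = 0" for w
        using Suc.IH [of w] that by (auto simp: p_def)
      show "poly p (- 1) = 0"
        unfolding p_def cpoly_mult by (simp add: map_poly_pCons)
    qed simp
    moreover have "of_nat (2 * n + 1) * z + (1 - z\<^sup>2) * (poly (pderiv p) z / poly p z) =
        ((2 * of_nat n + 1) * z * poly p z + (1 - z\<^sup>2) * poly (pderiv p) z) / poly p z"
      using nz by (simp add: field_simps)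
    moreover have "(2 * of_nat n + 1) * z * poly p z + (1 - z\<^sup>2) * poly (pderiv p) z = 0"
      using step Suc.prems z(1) by (metis mult_eq_0_iff)
    ultimately show False by (metis div_0 order_less_irrefl zero_complex.sel(1))
  qed
qed

lemma T2_roots: "poly (cpoly (T2 n)) z = 0 \<Longrightarrow> z = 0 \<or> Re z < 0"
  by (rule F_roots [of n]) (simp add: cpoly_mult del: mult_pCons_left)

text \<open>If \<open>0\<close> were the only possible zero, \<open>p\<close> would be a monomial.
  This will supply \<open>T2\<close> with a zero in the open left half-plane.\<close>

lemma ex_nonzero_root:
  fixes p :: "complex poly"
  assumes "coeff p i \<noteq> 0" "coeff p j \<noteq> 0" "i \<noteq> j"
  shows "\<exists>r. poly p r = 0 \<and> r \<noteq> 0"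
proof (rule ccontr)
  assume *: "\<not> ?thesis"
  have "p \<noteq> 0" using assms by auto
  then have "\<forall>r\<in>#proots p. r = 0" using * by auto
  moreover have "(\<Prod>r\<in>#A. [:-r, 1:]) = [:0, 1:] ^ size A" if "\<forall>r\<in>#A. r = 0"
    for A :: "complex multiset"
    using that by (induction A) simp_all
  ultimately have "(\<Prod>r\<in>#proots p. [:-r, 1:]) = [:0, 1:] ^ size (proots p)" by blast
  then have "p = monom (lead_coeff p) (size (proots p))"
    using complex_poly_decompose_multiset [of p] by (simp add: monom_altdef)
  then show False using assms by (metis coeff_monom)
qed

section \<open>Interlacing\<close>

context
  fixes a b p :: "real poly" and r :: complex
  assumes p: "p = pcompose a [:0, 0, 1:] + [:0, 1:] * pcompose b [:0, 0, 1:]"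
    and roots: "\<And>w. poly (cpoly p) w = 0 \<Longrightarrow> w = 0 \<or> Re w < 0"
    and r: "poly (cpoly p) r = 0" "Re r < 0"
begin

lemma poly_even_odd: "poly (cpoly p) z = poly (cpoly a) (z\<^sup>2) + z * poly (cpoly b) (z\<^sup>2)"
  unfolding p cpoly_add cpoly_mult cpoly_pcompose
  by (simp add: poly_pcompose map_poly_pCons power2_eq_square)

text \<open>If \<open>a\<close> or \<open>b\<close> vanishes at z^2, then p(-z) = p(z) or p(-z) =
  -p(z), contradicting \<open>cmod_poly_minus_less\<close> when \<open>Re z > 0\<close>. Hence the
  square root \<open>csqrt w\<close> is purely imaginary.\<close>

lemma roots_even_odd_parts:
  assumes "poly (cpoly a) w = 0 \<or> poly (cpoly b) w = 0"
  obtains t :: real where "w = - (of_real t)\<^sup>2"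
proof -
  define z where "z = csqrt w"
  have w: "w = z\<^sup>2" by (simp add: z_def)
  have "0 \<le> Re z" using csqrt_principal [of w] unfolding z_def by linarith
  have "\<not> 0 < Re z"
  proof
    assume z: "0 < Re z"
    have "cmod (poly (cpoly p) (- z)) < cmod (poly (cpoly p) z)"
    proof (rule cmod_poly_minus_less [OF _ z _ r])
      show "poly (cpoly p) z \<noteq> 0" using roots [of z] z by auto
    qed (use roots in fastforce)
    moreover have "poly (cpoly p) (- z) = poly (cpoly p) z \<or>
        poly (cpoly p) (- z) = - poly (cpoly p) z"
      using assms unfolding poly_even_odd w by auto
    ultimately show False by (metis norm_minus_cancel order_less_irrefl)
  qed
  then have "Re z = 0" using \<open>0 \<le> Re z\<close> by simp
  then have "w = - (of_real (Im z))\<^sup>2"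
    unfolding w by (simp add: complex_eq_iff power2_eq_square)
  then show ?thesis by (rule that)
qed

text \<open>This is Re (p'/p) > 0 at z = i t, cleared of its denominator. With a, b taken at
  \<open>y\<close>, it reads a b + 2 t^2 (a' b - a b') > 0, so it fixes the sign of a' b at zeros of
  \<open>a\<close> and of a b' at zeros of \<open>b\<close>.\<close>

lemma wronskian_pos:
  fixes t :: real
  assumes "t \<noteq> 0"
  defines "y \<equiv> - t\<^sup>2"
  shows "0 < poly a y * (poly b y - 2 * t\<^sup>2 * poly (pderiv b) y)
    + 2 * t\<^sup>2 * poly (pderiv a) y * poly b y"
proof -
  define z where "z = \<i> * complex_of_real t"
  have z2: "z\<^sup>2 = of_real y" by (simp add: z_def y_def power_mult_distrib)
  have nz: "poly (cpoly p) z \<noteq> 0"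
    using roots [of z] assms by (auto simp: z_def)
  have "poly (cpoly p) z = of_real (poly a y) + z * of_real (poly b y)"
    unfolding poly_even_odd z2 poly_cpoly_of_real ..
  then have v: "poly (cpoly p) z = Complex (poly a y) (t * poly b y)"
    by (simp add: z_def complex_eq_iff)
  have "pderiv p = [:0, 2:] * pcompose (pderiv a) [:0, 0, 1:] + (pcompose b [:0, 0, 1:]
      + [:0, 0, 2:] * pcompose (pderiv b) [:0, 0, 1:])"
    unfolding p by (simp add: pderiv_add pderiv_mult pderiv_pcompose pderiv_pCons algebra_simps)
  then have "poly (pderiv (cpoly p)) z = 2 * z * of_real (poly (pderiv a) y)
      + (of_real (poly b y) + 2 * z\<^sup>2 * of_real (poly (pderiv b) y))"
    unfolding cpoly_pderiv [symmetric]
    by (simp add: cpoly_add cpoly_mult cpoly_pcompose poly_pcompose map_poly_pCons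
        power2_eq_square [symmetric] z2 poly_cpoly_of_real del: mult_pCons_left)
  then have d: "poly (pderiv (cpoly p)) z =
      Complex (poly b y - 2 * t\<^sup>2 * poly (pderiv b) y) (2 * t * poly (pderiv a) y)"
    unfolding z2 by (simp add: z_def y_def complex_eq_iff)
  have "0 < Re (poly (pderiv (cpoly p)) z / poly (cpoly p) z)"
  proof (rule Re_pderiv_over_poly_pos [OF nz _ _ r])
    show "0 \<le> Re z" by (simp add: z_def)
    show "Re w \<le> 0" if "poly (cpoly p) w = 0" for w using roots [OF that] by auto
  qed
  then have "0 < Re (poly (pderiv (cpoly p)) z * cnj (poly (cpoly p) z))"
    using nz unfolding Re_divide_eq by (simp add: zero_less_divide_iff)
  then show ?thesis unfolding v d by (simp add: algebra_simps power2_eq_square)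
qed

end

section \<open>Zero lists and an interlacing criterion\<close>

lemma proots_rsquarefree:
  fixes p :: "'a :: field_char_0 poly"
  assumes "rsquarefree p"
  shows "proots p = mset_set {x. poly p x = 0}"
proof (rule multiset_eqI)
  fix x
  have "p \<noteq> 0" using assms by (simp add: rsquarefree_def)
  then show "count (proots p) x = count (mset_set {x. poly p x = 0}) x"
    using assms poly_roots_finite [of p]
    by (cases "poly p x = 0") (simp_all add: rsquarefree_root_order order_0I)
qed

text \<open>The length is computed over the complex numbers, where the degree counts zeros with
  multiplicity: real-rootedness makes all of them real, and then square-freeness makes them simple
  over the complex numbers too.\<close>

lemma zeros_desc_rsquarefree:
  assumes "rsquarefree f" "real_rooted f"
  shows "set (zeros_desc f) = {x. poly f x = 0}"
    and "length (zeros_desc f) = degree f"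
    and "sorted_wrt (>) (zeros_desc f)"
proof -
  have nz: "f \<noteq> 0" using assms(1) by (simp add: rsquarefree_def)
  then have fin: "finite {x. poly f x = 0}" by (rule poly_roots_finite)
  have z: "zeros_desc f = rev (sorted_list_of_set {x. poly f x = 0})"
    by (simp add: zeros_desc_def proots_rsquarefree [OF assms(1)] sorted_list_of_mset_set)
  show "set (zeros_desc f) = {x. poly f x = 0}" using fin by (simp add: z)
  show "sorted_wrt (>) (zeros_desc f)" by (simp add: z sorted_wrt_rev)
  have roots: "{w. poly (cpoly f) w = 0} = of_real ` {x. poly f x = 0}"
    using assms(2) by (auto simp: real_rooted_def poly_cpoly_of_real elim!: Reals_cases)
  have "rsquarefree (cpoly f)"
    unfolding rsquarefree_roots
  proof (intro allI notI, elim conjE)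
    fix w assume w: "poly (cpoly f) w = 0" "poly (pderiv (cpoly f)) w = 0"
    then obtain x where "w = of_real x" "poly f x = 0" using roots by auto
    then show False
      using w assms(1) by (auto simp: cpoly_pderiv [symmetric] poly_cpoly_of_real rsquarefree_roots)
  qed
  then have "degree (cpoly f) = card {w. poly (cpoly f) w = 0}"
    by (metis proots_rsquarefree size_mset_set size_proots_complex)
  then show "length (zeros_desc f) = degree f"
    unfolding z roots by (simp add: card_image inj_on_def degree_map_poly)
qed

text \<open>If \<open>q\<close> had constant sign on the interval, then \<open>p\<close> would cross zero in the same direction
  at both ends.\<close>

lemma root_between:
  fixes p q :: "real poly"
  assumes "u < v" "poly p u = 0" "poly p v = 0"
    and "0 < poly (pderiv p) u * poly q u" "0 < poly (pderiv p) v * poly q v"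
  shows "\<exists>x. u < x \<and> x < v \<and> (poly p x = 0 \<or> poly q x = 0)"
proof (cases "0 < poly q u * poly q v")
  case False
  then have "poly q u * poly q v < 0"
    using assms by (metis linorder_cases mult_eq_0_iff order_less_irrefl)
  then show ?thesis using poly_IVT [OF assms(1)] by blast
next
  case True
  have *: "\<exists>x. u < x \<and> x < v \<and> poly f x = 0"
    if f: "poly f u = 0" "poly f v = 0" "0 < poly (pderiv f) u" "0 < poly (pderiv f) v" for f
  proof -
    obtain d where d: "0 < d" "\<And>h. 0 < h \<Longrightarrow> h < d \<Longrightarrow> poly f u < poly f (u + h)"
      using DERIV_pos_inc_right [OF poly_DERIV f(3)] by blast
    obtain e where e: "0 < e" "\<And>h. 0 < h \<Longrightarrow> h < e \<Longrightarrow> poly f (v - h) < poly f v"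
      using DERIV_pos_inc_left [OF poly_DERIV f(4)] by blast
    \<comment> \<open>\<open>f\<close> is positive just right of \<open>u\<close> and negative just
      left of \<open>v\<close>; a third of the minimum keeps \<open>u + h\<close> left of
      \<open>v - h\<close>.\<close>
    define h where "h = min (min d e) (v - u) / 3"
    have h: "0 < h" "h < d" "h < e" "u + h < v - h"
    proof -
      have "h \<le> d / 3" "h \<le> e / 3" "3 * h \<le> v - u" by (simp_all add: h_def)
      then show "h < d" "h < e" "u + h < v - h" using d(1) e(1) assms(1) by linarith+
      show "0 < h" using d(1) e(1) assms(1) by (simp add: h_def)
    qed
    then have "0 < poly f (u + h)" "poly f (v - h) < 0" using d(2) e(2) f by auto
    then obtain x where "u + h < x" "x < v - h" "poly f x = 0"
      using poly_IVT_neg [OF h(4)] by blast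
    then show ?thesis using h by (intro exI [of _ x]) auto
  qed
  show ?thesis
  proof (cases "0 < poly q u")
    case True
    then show ?thesis
      using * [of p] assms \<open>0 < poly q u * poly q v\<close> by (auto simp: zero_less_mult_iff)
  next
    case False
    then show ?thesis
      using * [of "- p"] assms \<open>0 < poly q u * poly q v\<close>
      by (auto simp: zero_less_mult_iff pderiv_minus)
  qed
qed

lemma root_above:
  fixes p :: "real poly"
  assumes "0 < lead_coeff p" "poly p x < 0"
  shows "\<exists>y>x. poly p y = 0"
proof -
  obtain c where c: "\<And>y. c \<le> y \<Longrightarrow> lead_coeff p \<le> poly p y"
    using poly_pinfty_gt_lc [OF assms(1)] by blast
  have "0 < poly p (max c (x + 1))" using c [of "max c (x + 1)"] assms(1) by linarith
  then show ?thesis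
    using poly_IVT_pos [of x "max c (x + 1)" p] assms(2) by (auto simp: less_max_iff_disj)
qed

text \<open>The sign conditions make all zeros simple and rule out common ones. By
  \<open>root_between\<close>, consecutive zeros of either polynomial enclose a zero of the other;
  the leading coefficients force the largest zero to belong to \<open>f\<close>.\<close>

lemma interlacesI:
  fixes f g :: "real poly"
  assumes rr: "real_rooted f" "real_rooted g"
    and deg: "degree f = degree g" and lc: "0 < lead_coeff f" "0 < lead_coeff g"
    and f: "\<And>x. poly f x = 0 \<Longrightarrow> 0 < poly (pderiv f) x * poly g x"
    and g: "\<And>x. poly g x = 0 \<Longrightarrow> poly f x * poly (pderiv g) x < 0"
  shows "interlaces g f"
proof -
  define r s d where "r = zeros_desc f" and "s = zeros_desc g" and "d = degree f"
  have sf: "rsquarefree f" "rsquarefree g"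
    unfolding rsquarefree_roots using f g by (metis mult_zero_left mult_zero_right order_less_irrefl)+
  have r: "set r = {x. poly f x = 0}" "length r = d" "\<And>i j. i < j \<Longrightarrow> j < d \<Longrightarrow> r ! j < r ! i"
    using zeros_desc_rsquarefree [OF sf(1) rr(1)] by (auto simp: r_def d_def sorted_wrt_iff_nth_less)
  have s: "set s = {x. poly g x = 0}" "length s = d" "\<And>i j. i < j \<Longrightarrow> j < d \<Longrightarrow> s ! j < s ! i"
    using zeros_desc_rsquarefree [OF sf(2) rr(2)] deg
    by (auto simp: s_def d_def sorted_wrt_iff_nth_less)
  have r_anti: "r ! j \<le> r ! i" and s_anti: "s ! j \<le> s ! i" if "i \<le> j" "j < d" for i j
    using r(3) [of i j] s(3) [of i j] that by (auto simp: le_less)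
  have r_root: "poly f (r ! i) = 0" and s_root: "poly g (s ! i) = 0" if "i < d" for i
    using that nth_mem [of i r] nth_mem [of i s] unfolding r(1,2) s(1,2) by simp_all
  have r_idx: "\<exists>i<d. x = r ! i" if "poly f x = 0" for x
  proof -
    have "x \<in> set r" using that r(1) by simp
    then show ?thesis unfolding in_set_conv_nth r(2) by auto
  qed
  have s_idx: "\<exists>i<d. x = s ! i" if "poly g x = 0" for x
  proof -
    have "x \<in> set s" using that s(1) by simp
    then show ?thesis unfolding in_set_conv_nth s(2) by auto
  qed
  have r_between: "\<exists>j<d. r ! Suc i < s ! j \<and> s ! j < r ! i" if i: "Suc i < d" for i
  proof -
    obtain x where x: "r ! Suc i < x" "x < r ! i" "poly f x = 0 \<or> poly g x = 0"
      using root_between [of "r ! Suc i" "r ! i" f g] r(3) [of i "Suc i"]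
        r_root [of i] r_root [of "Suc i"] f [of "r ! i"] f [of "r ! Suc i"] i by auto
    have "poly f x \<noteq> 0"
    proof
      assume "poly f x = 0"
      then obtain j where "j < d" "x = r ! j" using r_idx by blast
      then show False
        using x r_anti [of j i] r_anti [of "Suc i" j] i by linarith
    qed
    then show ?thesis using x s_idx by blast
  qed
  have s_between: "\<exists>j<d. s ! Suc i < r ! j \<and> r ! j < s ! i" if i: "Suc i < d" for i
  proof -
    \<comment> \<open>Hypothesis \<open>g\<close> has the opposite sign, so
      \<open>root_between\<close> is applied with \<open>- f\<close>.\<close>
    have "0 < poly (pderiv g) (s ! j) * poly (- f) (s ! j)" if "j < d" for j
      using g [OF s_root [OF that]] by (simp add: mult.commute)
    from this [of i] this [of "Suc i"] obtain x
      where x: "s ! Suc i < x" "x < s ! i" "poly g x = 0 \<or> poly (- f) x = 0"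
      using root_between [of "s ! Suc i" "s ! i" g "- f"] s(3) [of i "Suc i"]
        s_root [of i] s_root [of "Suc i"] i by auto
    have "poly g x \<noteq> 0"
    proof
      assume "poly g x = 0"
      then obtain j where "j < d" "x = s ! j" using s_idx by blast
      then show False
        using x s_anti [of j i] s_anti [of "Suc i" j] i by linarith
    qed
    then show ?thesis using x r_idx by auto
  qed
  have le: "s ! i \<le> r ! i" if "i < d" for i
    using that
  proof (induction i)
    case 0
    have d: "0 < d" by (rule 0)
    have s_max: "x \<le> s ! 0" if "poly g x = 0" for x
      using s_idx [OF that] s_anti [of 0] by auto
    have r_max: "x \<le> r ! 0" if "poly f x = 0" for x
      using r_idx [OF that] r_anti [of 0] by auto
    \<comment> \<open>Were \<open>g\<close> decreasing at its largest zero, it would be negative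
      just beyond and have a larger zero. So \<open>f\<close> is negative at \<open>s ! 0\<close>
      and has a zero above it.\<close>
    have "\<not> poly (pderiv g) (s ! 0) < 0"
    proof
      assume "poly (pderiv g) (s ! 0) < 0"
      then obtain e where e: "0 < e" "\<And>h. 0 < h \<Longrightarrow> h < e \<Longrightarrow> poly g (s ! 0 + h) < poly g (s ! 0)"
        using DERIV_neg_dec_right [OF poly_DERIV] by blast
      have "poly g (s ! 0 + e / 2) < 0" using e(2) [of "e / 2"] e(1) s_root [OF d] by simp
      then obtain x where "s ! 0 + e / 2 < x" "poly g x = 0"
        using root_above [OF lc(2)] by blast
      then show False using s_max [of x] e(1) by simp
    qed
    then have "poly f (s ! 0) < 0"
      using g [OF s_root [OF d]] by (auto simp: mult_less_0_iff)
    then show ?case using root_above [OF lc(1)] r_max by (meson less_imp_le order_trans)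
  next
    case (Suc i)
    obtain j where j: "j < d" "s ! Suc i < r ! j" "r ! j < s ! i" using s_between Suc.prems by blast
    \<comment> \<open>By induction hypothesis this zero of \<open>f\<close> lies below
      \<open>r ! i\<close>, so its index is at least \<open>Suc i\<close>.\<close>
    have "r ! j < r ! i" using j Suc by simp
    then have "\<not> j \<le> i" using r_anti [of j i] Suc.prems by auto
    then have "r ! j \<le> r ! Suc i" using r_anti [of "Suc i" j] j by simp
    then show ?case using j by simp
  qed
  have ge: "r ! Suc i \<le> s ! i" if "Suc i < d" for i
    using that
  proof (induction i)
    case 0
    then obtain j where j: "j < d" "r ! 1 < s ! j" using r_between [of 0] by auto
    then have "s ! j \<le> s ! 0" using s_anti [of 0 j] by simp
    then show ?case using j by simp
  next
    case (Suc i)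
    obtain j where j: "j < d" "r ! Suc (Suc i) < s ! j" "s ! j < r ! Suc i"
      using r_between Suc.prems by blast
    have "s ! j < s ! i" using j Suc by simp
    then have "\<not> j \<le> i" using s_anti [of j i] Suc.prems by auto
    then have "s ! j \<le> s ! Suc i" using s_anti [of "Suc i" j] j by simp
    then show ?case using j by simp
  qed
  have "f \<noteq> 0" "g \<noteq> 0" using lc by auto
  then show ?thesis
    unfolding interlaces_def Let_def using rr deg le ge by (simp add: r_def s_def d_def)
qed

text \<open>For \<open>n = 0\<close> and \<open>n = 1\<close> one of \<open>a\<close>,
  \<open>b\<close> vanishes and the zero convention applies; for larger \<open>n\<close> the
  Hermite-Biehler lemmas feed \<open>interlacesI\<close>.\<close>

lemma decomposition_Mtilde2_interlaces:
  assumes dec: "recip_decomposition n (Mtilde2 n) a b"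
  shows "b \<lless> a"
proof (cases n)
  case 0
  then have "b = 0" "a = 1" using dec by (auto simp: recip_decomposition_def)
  then show ?thesis by (simp add: interlaces_signed_def real_rooted_def)
next
  case (Suc k)
  have dec': "recip_decomposition (Suc k) (Mtilde2 (Suc k)) a b" using dec Suc by simp
  have M: "M2 (Suc k) = a + b" by (rule M2_decomposition [OF dec'])
  have ab: "coeff (Mtilde2 (Suc k)) i = coeff a i + (if i = 0 then 0 else coeff b (i - 1))"
    and a: "coeff a i = (if i \<le> Suc k then coeff a (Suc k - i) else 0)"
    and b: "coeff b i = (if i < Suc k then coeff b (k - i) else 0)" for i
    using dec' unfolding recip_decomposition_coeff by simp_all
  have a0: "coeff a 0 = 0"
    using ab [of 0]
    by (simp add: coeff_Mtilde2_Suc_eq coeff_M2_Suc_eq_0 del: M2.simps(2) Mtilde2.simps(2))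
  have b0: "coeff b 0 = 1"
    using arg_cong [OF M, of "\<lambda>p. coeff p 0"] a0 by (simp del: M2.simps(2))
  have a1: "coeff a 1 = 2 ^ k - 1"
    using ab [of 1] b0 by (simp add: coeff_Mtilde2_Suc_eq coeff_M2_top del: M2.simps(2) Mtilde2.simps(2))
  have a_Suc: "coeff a (Suc k) = 0" using a [of "Suc k"] a0 by simp
  have a_k: "coeff a k = coeff a 1" using a [of k] by simp
  have b_k: "coeff b k = 1" using b [of k] b0 by simp
  have deg_b: "degree b = k"
  proof (rule antisym)
    have "coeff b i = 0" if "k < i" for i using b [of i] that by simp
    then show "degree b \<le> k" by (intro degree_le) blast
  qed (simp add: b_k le_degree)
  \<comment> \<open>Symmetry in degree \<open>Suc k\<close> and \<open>a0\<close> kill the top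
    coefficient, so \<open>a\<close> will have the same degree as \<open>b\<close>.\<close>
  have deg_a: "degree a \<le> k"
  proof -
    have "coeff a i = 0" if "k < i" for i
      using a [of i] a_Suc that by (cases "i = Suc k") simp_all
    then show ?thesis by (intro degree_le) blast
  qed
  show ?thesis
  proof (cases "k = 0")
    case True
    then have "a = 0" using deg_a a0 by (auto elim: degree_eq_zeroE)
    moreover obtain c where "b = [:c:]" "c \<noteq> 0"
      using deg_b b0 True by (auto elim: degree_eq_zeroE)
    ultimately show ?thesis by (simp add: interlaces_signed_def real_rooted_def map_poly_pCons)
  next
    case False
    have a1_pos: "0 < coeff a 1" using False unfolding a1 by simp
    have deg_a: "degree a = k"
      using deg_a a1_pos a_k by (intro antisym le_degree) auto
    define p where "p = T2 (Suc k)"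
    have p: "p = pcompose a [:0, 0, 1:] + [:0, 1:] * pcompose b [:0, 0, 1:]"
      unfolding p_def by (rule T2_decomposition [OF dec'])
    have roots: "w = 0 \<or> Re w < 0" if "poly (cpoly p) w = 0" for w
      using that unfolding p_def by (rule T2_roots)
    \<comment> \<open>The coefficients of x and x^2 in \<open>p\<close> are \<open>coeff b 0\<close>
      and \<open>coeff a 1\<close>, both nonzero, so \<open>p\<close> has a zero other than
      \<open>0\<close>.\<close>
    obtain r where r: "poly (cpoly p) r = 0" "Re r < 0"
    proof -
      obtain a' where a': "a = pCons 0 (pCons (coeff a 1) a')"
        using a0 by (metis One_nat_def coeff_pCons_0 coeff_pCons_Suc pCons_cases)
      obtain b' where b': "b = pCons 1 b'"
        using b0 by (metis coeff_pCons_0 pCons_cases)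
      have "coeff p 1 = 1" "coeff p 2 = coeff a 1"
        unfolding p by (subst a', subst b', simp add: pcompose_pCons coeff_pCons numeral_2_eq_2)+
      then have "coeff (cpoly p) 1 \<noteq> 0" "coeff (cpoly p) 2 \<noteq> 0"
        using a1_pos by (simp_all add: coeff_map_poly)
      then obtain r where "poly (cpoly p) r = 0" "r \<noteq> 0"
        using ex_nonzero_root [of "cpoly p" 1 2] by auto
      then show ?thesis using roots that by blast
    qed
    note even_odd = roots_even_odd_parts [OF p roots r] and wr = wronskian_pos [OF p roots r]
    have rr: "real_rooted a" "real_rooted b"
      unfolding real_rooted_def
      by (metis even_odd Reals_minus_iff Reals_of_real Reals_power)+
    have root: "\<exists>t. y = - t\<^sup>2" if "poly a y = 0 \<or> poly b y = 0" for y
    proof -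
      have "poly (cpoly a) (of_real y) = 0 \<or> poly (cpoly b) (of_real y) = 0"
        using that by (auto simp: poly_cpoly_of_real)
      then obtain t where "complex_of_real y = - (of_real t)\<^sup>2" using even_odd by blast
      then have "y = - t\<^sup>2" by (metis of_real_eq_iff of_real_minus of_real_power)
      then show ?thesis ..
    qed
    have "interlaces b a"
    proof (rule interlacesI [OF rr])
      show "degree a = degree b" using deg_a deg_b by simp
      show "0 < lead_coeff a" "0 < lead_coeff b" using deg_a deg_b a_k b_k a1_pos by simp_all
      show "0 < poly (pderiv a) y * poly b y" if y: "poly a y = 0" for y
      proof -
        obtain t where t: "y = - t\<^sup>2" using root y by blast
        show ?thesis
        \<comment> \<open>\<open>wr\<close> is silent at \<open>t = 0\<close>; there the values at
          \<open>0\<close> are the coefficients \<open>coeff a 1\<close> and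
          \<open>coeff b 0\<close>, both positive.\<close>
        proof (cases "t = 0")
          case True
          then show ?thesis
            using t a1_pos b0 by (simp add: poly_0_coeff_0 coeff_pderiv)
        next
          case False
          have "0 < 2 * t\<^sup>2 * (poly (pderiv a) y * poly b y)"
            using wr [OF _ False] y t by (simp add: mult.assoc)
          then show ?thesis using False by (simp add: zero_less_mult_iff)
        qed
      qed
      show "poly a y * poly (pderiv b) y < 0" if y: "poly b y = 0" for y
      proof -
        obtain t where t: "y = - t\<^sup>2" using root y by blast
        have "t \<noteq> 0" using t y b0 by (auto simp: poly_0_coeff_0)
        then have "2 * t\<^sup>2 * (poly a y * poly (pderiv b) y) < 0"
          using wr [of t] y t by (simp add: algebra_simps)
        then show ?thesis using \<open>t \<noteq> 0\<close> by (simp add: mult_less_0_iff)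
      qed
    qed
    then show ?thesis
      using deg_a deg_b a_k b_k a1_pos by (simp add: interlaces_signed_def)
  qed
qed

theorem proposition5p16:
  fixes n :: nat
  shows "hurwitz_stable (map_poly complex_of_real (T2 n))
    \<and> (\<forall>a b. recip_decomposition n (Mtilde2 n) a b \<longrightarrow> b \<lless> a)
    \<and> alternatingly_increasing (M2 n)
    \<and> alternatingly_increasing (Mtilde2 n)"
proof -
  have "poly (cpoly (T2 n)) z \<noteq> 0" if "0 < Re z" for z
    using T2_roots [of n z] that by auto
  then have "hurwitz_stable (cpoly (T2 n))" by (simp add: hurwitz_stable_def)
  then show ?thesis
    using decomposition_Mtilde2_interlaces alternatingly_increasing_M2 alternatingly_increasing_Mtilde2
    by simp
qed

end
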